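(* Consider interval propagation on a finite database with a finite set of inequality rules and congruence rules (as defined in the context). Assume that every initial interval contains the true value of the corresponding invariant, that every true value is finite, and that every inequality and congruence condition used is valid for the true values. Then the fixed point reached by the propagation does not depend on the order in which the rules are applied: any two runs from the same initial interval assignment that terminate, and in which every rule has been applied at least once after the last strict update, produce the same interval assignment.
   Context: A database consists of finitely many knots $K$ and finitely many integer-valued invariants $X$. For each pair $(X,K)$ one stores an integer interval $[L_X(K),U_X(K)]\cap\mathbb Z$, whose endpoints may be infinite ($L_X\in\mathbb Z\cup\{-\infty\}$, $U_X\in\mathbb Z\cup\{+\infty\}$). The true value is the integer $X(K)$. The rules are of two kinds, applied for a fixed knot $K$: - Inequality propagation, for an inequality $X\ge Y$ in the rule set: $L_X\leftarrow\max\{L_X,L_Y\}$ and $U_Y\leftarrow\min\{U_Y,U_X\}$. - Congruence projection, for a congruence condition $X\equiv r \pmod m$ with $m\ge 1$ in the rule set: replace $[L_X,U_X]$ by the interval hull of $[L_X,U_X]\cap(r+m\mathbb Z)$, i.e. a finite lower endpoint is rounded up to the least admissible integer, a finite upper endpoint is rounded down to the greatest admissible integer, and infinite endpoints remain infinite. An empty intersection is reported as a contradiction. A rule is valid if the inequality $X(K)\ge Y(K)$ (resp. the congruence $X(K)\equiv r \pmod m$) holds for the true values. A run is a sequence of successive rule applications starting from the initial interval assignment; a strict update is an application step which changes some endpoint. A fixed point is an assignment left unchanged by every rule. *)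

theory Defs
  imports "HOL-Library.Extended" "HOL-Number_Theory.Cong"
begin

text \<open>
  An assignment stores, for an invariant X (type 'x) and a knot K (type 'k), the
  endpoints of an interval of integers. Interval endpoints may cross: inequality
  propagation by itself never reports a contradiction.
\<close>

record ('x, 'k) assignment =
  lower :: "'x \<Rightarrow> 'k \<Rightarrow> int extended"
  upper :: "'x \<Rightarrow> 'k \<Rightarrow> int extended"

definition admissible_endpoints :: "'x set \<Rightarrow> 'k set \<Rightarrow> ('x, 'k) assignment \<Rightarrow> bool" where
  "admissible_endpoints Xs Ks A \<longleftrightarrow>
     (\<forall>X\<in>Xs. \<forall>K\<in>Ks. lower A X K \<noteq> Pinf \<and> upper A X K \<noteq> Minf)"

definition stored_interval :: "('x, 'k) assignment \<Rightarrow> 'x \<Rightarrow> 'k \<Rightarrow> int set" where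
  "stored_interval A X K = {n. lower A X K \<le> Fin n \<and> Fin n \<le> upper A X K}"

text \<open>\<open>Inequality X Y\<close> stands for X \<ge> Y, and \<open>Congruence X r m\<close> for X \<equiv> r (mod m).\<close>

datatype 'x rule = Inequality 'x 'x | Congruence 'x int int

fun rule_over :: "'x set \<Rightarrow> 'x rule \<Rightarrow> bool" where
  "rule_over Xs (Inequality X Y) \<longleftrightarrow> X \<in> Xs \<and> Y \<in> Xs"
| "rule_over Xs (Congruence X r m) \<longleftrightarrow> X \<in> Xs \<and> m \<ge> 1"

fun valid_rule :: "('x \<Rightarrow> 'k \<Rightarrow> int) \<Rightarrow> 'k \<Rightarrow> 'x rule \<Rightarrow> bool" where
  "valid_rule val K (Inequality X Y) \<longleftrightarrow> val X K \<ge> val Y K"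
| "valid_rule val K (Congruence X r m) \<longleftrightarrow> [val X K = r] (mod m)"

definition set_lower ::
  "'x \<Rightarrow> 'k \<Rightarrow> int extended \<Rightarrow> ('x, 'k) assignment \<Rightarrow> ('x, 'k) assignment" where
  "set_lower X K l A = A\<lparr>lower := (lower A)(X := (lower A X)(K := l))\<rparr>"

definition set_upper ::
  "'x \<Rightarrow> 'k \<Rightarrow> int extended \<Rightarrow> ('x, 'k) assignment \<Rightarrow> ('x, 'k) assignment" where
  "set_upper X K u A = A\<lparr>upper := (upper A)(X := (upper A X)(K := u))\<rparr>"

fun round_up :: "int \<Rightarrow> int \<Rightarrow> int extended \<Rightarrow> int extended" where
  "round_up r m (Fin a) = Fin (LEAST n. a \<le> n \<and> [n = r] (mod m))"
| "round_up r m Pinf = Pinf"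
| "round_up r m Minf = Minf"

fun round_down :: "int \<Rightarrow> int \<Rightarrow> int extended \<Rightarrow> int extended" where
  "round_down r m (Fin b) = Fin (GREATEST n. n \<le> b \<and> [n = r] (mod m))"
| "round_down r m Pinf = Pinf"
| "round_down r m Minf = Minf"

text \<open>The result \<open>None\<close> is the report of a contradiction.\<close>

fun apply_rule ::
  "'x rule \<times> 'k \<Rightarrow> ('x, 'k) assignment \<Rightarrow> ('x, 'k) assignment option" where
  "apply_rule (Inequality X Y, K) A =
     Some (set_lower X K (max (lower A X K) (lower A Y K))
            (set_upper Y K (min (upper A Y K) (upper A X K)) A))"
| "apply_rule (Congruence X r m, K) A =
     (if stored_interval A X K \<inter> {n. [n = r] (mod m)} = {} then None
      else Some (set_lower X K (round_up r m (lower A X K))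
                  (set_upper X K (round_down r m (upper A X K)) A)))"

text \<open>
  A terminating run is given by the finite list of its steps, each of which is a rule
  together with the knot to which it is applied. A contradiction ends all processing.
\<close>

fun run ::
  "('x, 'k) assignment \<Rightarrow> ('x rule \<times> 'k) list \<Rightarrow> ('x, 'k) assignment option" where
  "run A [] = Some A"
| "run A (s # ss) = Option.bind (apply_rule s A) (\<lambda>B. run B ss)"

definition strict_update ::
  "('x, 'k) assignment \<Rightarrow> ('x rule \<times> 'k) list \<Rightarrow> nat \<Rightarrow> bool" where
  "strict_update A ss i \<longleftrightarrow> i < length ss \<and>
     (\<exists>B C. run A (take i ss) = Some B \<and> run A (take (Suc i) ss) = Some C \<and> B \<noteq> C)"

text \<open>If there is no strict update at all, every rule still has to occur in the run.\<close>

definition all_applied_after_last_update ::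
  "'x rule set \<Rightarrow> 'k set \<Rightarrow> ('x, 'k) assignment \<Rightarrow> ('x rule \<times> 'k) list \<Rightarrow> bool" where
  "all_applied_after_last_update R Ks A ss \<longleftrightarrow>
     (\<forall>s \<in> R \<times> Ks. \<exists>j < length ss. ss ! j = s \<and> (\<forall>i. strict_update A ss i \<longrightarrow> i < j))"

definition fixed_point :: "'x rule set \<Rightarrow> 'k set \<Rightarrow> ('x, 'k) assignment \<Rightarrow> bool" where
  "fixed_point R Ks A \<longleftrightarrow> (\<forall>s \<in> R \<times> Ks. apply_rule s A = Some A)"

end

theory Submission
  imports Defs
begin

text \<open>
  Order assignments by refinement: one assignment refines another if each of its intervals
  is contained, endpoint by endpoint, in the corresponding interval of the other. A rule
  application is then an extensive (\<open>refine_apply_rule\<close>) and monotone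
  (\<open>apply_rule_mono\<close>) partial operation, and the argument is the usual one for
  closure operators. Validity of the rules keeps the true values inside the intervals, so
  that no contradiction is ever reported and every run has a final assignment
  (\<open>run_sound\<close>).

  The final assignment \<open>A\<close> of a run that ends with an idle application of every rule is a
  fixed point (\<open>run_reaches_fixed_point\<close>). Let \<open>C\<close> be the final assignment of another
  such run from the same start. By extensivity \<open>C\<close> refines the initial assignment, and since
  \<open>C\<close> is fixed by all rules, monotonicity carries ``is refined by \<open>C\<close>'' along the first run
  (\<open>run_below_fixed_point\<close>), so \<open>C\<close> refines \<open>A\<close>. By symmetry \<open>A\<close> refines \<open>C\<close>, and
  refinement is antisymmetric. In other words, the common result is the coarsest fixed point
  that refines the initial assignment.
\<close>

section \<open>Rounding to a residue class\<close>

text \<open>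
  On the integers \<open>LEAST\<close> and \<open>GREATEST\<close> are meaningful only where an extremum exists; the
  closed forms show that for \<open>m \<ge> 1\<close> it does. The least member of the class above \<open>a\<close> lies
  at distance \<open>(r - a) mod m\<close>, because every \<open>n \<ge> a\<close> in the class has
  \<open>n - a \<ge> (n - a) mod m = (r - a) mod m\<close>.
\<close>

lemma round_up_Fin:
  assumes "m \<ge> 1"
  shows "round_up r m (Fin a) = Fin (a + (r - a) mod m)"
proof -
  have "(LEAST n. a \<le> n \<and> [n = r] (mod m)) = a + (r - a) mod m"
  proof (rule Least_equality)
    show "a \<le> a + (r - a) mod m \<and> [a + (r - a) mod m = r] (mod m)"
      using assms by (simp add: cong_def mod_add_right_eq)
  next
    fix n assume n: "a \<le> n \<and> [n = r] (mod m)"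
    then have "(r - a) mod m = (n - a) mod m"
      by (metis cong_def mod_diff_left_eq)
    also have "\<dots> \<le> n - a"
      using n by (intro zmod_le_nonneg_dividend) simp
    finally show "a + (r - a) mod m \<le> n" by simp
  qed
  then show ?thesis by simp
qed

lemma round_down_Fin:
  assumes "m \<ge> 1"
  shows "round_down r m (Fin b) = Fin (b - (b - r) mod m)"
proof -
  have "(GREATEST n. n \<le> b \<and> [n = r] (mod m)) = b - (b - r) mod m"
  proof (rule Greatest_equality)
    show "b - (b - r) mod m \<le> b \<and> [b - (b - r) mod m = r] (mod m)"
      using assms by (simp add: cong_def mod_diff_right_eq)
  next
    fix n assume n: "n \<le> b \<and> [n = r] (mod m)"
    then have "(b - r) mod m = (b - n) mod m"
      by (metis cong_def mod_diff_right_eq)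
    also have "\<dots> \<le> b - n"
      using n by (intro zmod_le_nonneg_dividend) simp
    finally show "n \<le> b - (b - r) mod m" by simp
  qed
  then show ?thesis by simp
qed

lemma round_up_ge: "m \<ge> 1 \<Longrightarrow> x \<le> round_up r m x"
  by (cases x) (simp_all add: round_up_Fin del: round_up.simps(1))

lemma round_down_le: "m \<ge> 1 \<Longrightarrow> round_down r m x \<le> x"
  by (cases x) (simp_all add: round_down_Fin del: round_down.simps(1))

text \<open>
  Rounding discards no member of the class. These two facts give both the preservation of
  the true value and, applied to an endpoint that is already rounded, the monotonicity of
  rounding.
\<close>

lemma round_up_le_member:
  assumes "m \<ge> 1" "[n = r] (mod m)" "x \<le> Fin n"
  shows "round_up r m x \<le> Fin n"
proof (cases x)
  case (Fin a)
  have "(r - a) mod m = (n - a) mod m"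
    using assms(2) by (metis cong_def mod_diff_left_eq)
  also have "\<dots> \<le> n - a"
    using assms(3) Fin by (intro zmod_le_nonneg_dividend) simp
  finally show ?thesis using Fin assms(1) by (simp add: round_up_Fin del: round_up.simps(1))
qed (use assms in simp_all)

lemma round_down_ge_member:
  assumes "m \<ge> 1" "[n = r] (mod m)" "Fin n \<le> x"
  shows "Fin n \<le> round_down r m x"
proof (cases x)
  case (Fin b)
  have "(b - r) mod m = (b - n) mod m"
    using assms(2) by (metis cong_def mod_diff_right_eq)
  also have "\<dots> \<le> b - n"
    using assms(3) Fin by (intro zmod_le_nonneg_dividend) simp
  finally show ?thesis using Fin assms(1) by (simp add: round_down_Fin del: round_down.simps(1))
qed (use assms in simp_all)

lemma round_up_mono:
  assumes "m \<ge> 1" "x \<le> y"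
  shows "round_up r m x \<le> round_up r m y"
proof (cases y)
  case (Fin b)
  have "[b + (r - b) mod m = r] (mod m)"
    by (simp add: cong_def mod_add_right_eq)
  moreover have "x \<le> round_up r m y"
    using assms round_up_ge order_trans by blast
  ultimately show ?thesis
    using assms(1) Fin round_up_le_member by (metis round_up_Fin)
next
  case Minf
  then have "x = Minf" using assms(2) by (cases x) simp_all
  then show ?thesis by simp
qed simp

lemma round_down_mono:
  assumes "m \<ge> 1" "x \<le> y"
  shows "round_down r m x \<le> round_down r m y"
proof (cases x)
  case (Fin a)
  have "[a - (a - r) mod m = r] (mod m)"
    by (simp add: cong_def mod_diff_right_eq)
  moreover have "round_down r m x \<le> y"
    using assms round_down_le order_trans by blast
  ultimately show ?thesis
    using assms(1) Fin round_down_ge_member by (metis round_down_Fin)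
next
  case Pinf
  then have "y = Pinf" using assms(2) by (cases y) simp_all
  then show ?thesis by simp
qed simp

section \<open>Refinement of assignments\<close>

text \<open>
  The endpoints are compared rather than the stored sets of integers: distinct
  assignments with crossing endpoints store the same empty set, and on sets the relation
  would not be antisymmetric.
\<close>

definition refined_by :: "('x, 'k) assignment \<Rightarrow> ('x, 'k) assignment \<Rightarrow> bool" where
  "refined_by A B \<longleftrightarrow>
     (\<forall>X K. lower A X K \<le> lower B X K \<and> upper B X K \<le> upper A X K)"

lemma refined_by_refl: "refined_by A A"
  by (simp add: refined_by_def)

lemma refined_by_trans: "refined_by A B \<Longrightarrow> refined_by B C \<Longrightarrow> refined_by A C"
  unfolding refined_by_def by (meson order_trans)

lemma refined_by_antisym: "refined_by A B \<Longrightarrow> refined_by B A \<Longrightarrow> A = B"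
  unfolding refined_by_def
  by (intro assignment.equality ext) (auto intro: order.antisym)

lemma lower_set [simp]:
  "lower (set_lower X K l A) Y J = (if Y = X \<and> J = K then l else lower A Y J)"
  "lower (set_upper X K u A) = lower A"
  by (simp_all add: set_lower_def set_upper_def)

lemma upper_set [simp]:
  "upper (set_upper X K u A) Y J = (if Y = X \<and> J = K then u else upper A Y J)"
  "upper (set_lower X K l A) = upper A"
  by (simp_all add: set_lower_def set_upper_def)

lemma refine_apply_rule:
  assumes "rule_over Xs \<rho>" "apply_rule (\<rho>, K) A = Some B"
  shows "refined_by A B"
proof (cases \<rho>)
  case (Inequality X Y)
  then show ?thesis using assms(2) by (auto simp: refined_by_def)
next
  case (Congruence X r m)
  then show ?thesis using assms
    by (auto simp: refined_by_def round_up_ge round_down_le split: if_splits)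
qed

lemma apply_rule_mono:
  assumes "rule_over Xs \<rho>" "refined_by A B"
    and "apply_rule (\<rho>, K) A = Some A'" "apply_rule (\<rho>, K) B = Some B'"
  shows "refined_by A' B'"
proof (cases \<rho>)
  case (Inequality X Y)
  have "max (lower A X K) (lower A Y K) \<le> max (lower B X K) (lower B Y K)"
    and "min (upper B Y K) (upper B X K) \<le> min (upper A Y K) (upper A X K)"
    using assms(2) unfolding refined_by_def by (blast intro: max.mono min.mono)+
  then show ?thesis using Inequality assms(2-4)
    by (auto simp: refined_by_def simp del: max.bounded_iff min.bounded_iff)
next
  case (Congruence X r m)
  then show ?thesis using assms
    by (auto simp: refined_by_def round_up_mono round_down_mono split: if_splits)
qed

section \<open>Preservation of the true values\<close>

lemma apply_rule_sound:
  assumes "rule_over Xs \<rho>" "valid_rule val K \<rho>" "K \<in> Ks"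
    and "\<forall>X\<in>Xs. \<forall>K\<in>Ks. val X K \<in> stored_interval A X K"
  shows "\<exists>B. apply_rule (\<rho>, K) A = Some B \<and>
           (\<forall>X\<in>Xs. \<forall>K\<in>Ks. val X K \<in> stored_interval B X K)"
proof (cases \<rho>)
  case (Inequality X Y)
  with assms have X: "val X K \<in> stored_interval A X K"
    and Y: "val Y K \<in> stored_interval A Y K" and le: "Fin (val Y K) \<le> Fin (val X K)"
    by auto
  from Y le have "lower A Y K \<le> Fin (val X K)"
    unfolding stored_interval_def using order_trans by blast
  moreover from X le have "Fin (val Y K) \<le> upper A X K"
    unfolding stored_interval_def using order_trans by blast
  ultimately show ?thesis
    using Inequality assms(4) by (auto simp: stored_interval_def)
next
  case (Congruence X r m)
  with assms have X: "val X K \<in> stored_interval A X K" and m: "m \<ge> 1"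
    and c: "[val X K = r] (mod m)"
    by auto
  from X c have "stored_interval A X K \<inter> {n. [n = r] (mod m)} \<noteq> {}" by blast
  then show ?thesis
    using Congruence assms(4) X m c
    by (auto simp: stored_interval_def round_up_le_member round_down_ge_member)
qed

lemma run_sound:
  assumes "\<forall>\<rho>\<in>R. rule_over Xs \<rho>" "\<forall>\<rho>\<in>R. \<forall>K\<in>Ks. valid_rule val K \<rho>"
    and "\<forall>X\<in>Xs. \<forall>K\<in>Ks. val X K \<in> stored_interval A X K"
    and "set ss \<subseteq> R \<times> Ks"
  shows "\<exists>B. run A ss = Some B"
  using assms(3,4)
proof (induction ss arbitrary: A)
  case (Cons s ss)
  obtain \<rho> K where s: "s = (\<rho>, K)" by (cases s)
  with Cons.prems have "\<rho> \<in> R" "K \<in> Ks" by auto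
  then obtain B where "apply_rule s A = Some B"
    and "\<forall>X\<in>Xs. \<forall>K\<in>Ks. val X K \<in> stored_interval B X K"
    using apply_rule_sound[of Xs \<rho> val K Ks A] assms(1,2) Cons.prems(1) s by blast
  with Cons.IH[of B] Cons.prems(2) show ?case by simp
qed simp

section \<open>Runs and fixed points\<close>

lemma refine_run:
  assumes "\<forall>\<rho>\<in>R. rule_over Xs \<rho>" "set ss \<subseteq> R \<times> Ks" "run A ss = Some B"
  shows "refined_by A B"
  using assms(2,3)
proof (induction ss arbitrary: A)
  case (Cons s ss)
  obtain \<rho> K where s: "s = (\<rho>, K)" by (cases s)
  from Cons.prems(2) obtain A' where A': "apply_rule s A = Some A'" "run A' ss = Some B"
    by (auto simp: bind_eq_Some_conv)
  have "refined_by A A'"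
    using refine_apply_rule[of Xs \<rho> K A A'] A'(1) s Cons.prems(1) assms(1) by auto
  moreover have "refined_by A' B" using Cons.IH A'(2) Cons.prems(1) by simp
  ultimately show ?case by (rule refined_by_trans)
qed (simp add: refined_by_refl)

text \<open>
  A step takes an assignment refined by \<open>C\<close> to one refined by the result of the same step on
  \<open>C\<close>, and that result is \<open>C\<close> itself.
\<close>

lemma run_below_fixed_point:
  assumes "\<forall>\<rho>\<in>R. rule_over Xs \<rho>" "fixed_point R Ks C"
    and "set ss \<subseteq> R \<times> Ks" "run A ss = Some B" "refined_by A C"
  shows "refined_by B C"
  using assms(3-5)
proof (induction ss arbitrary: A)
  case (Cons s ss)
  obtain \<rho> K where s: "s = (\<rho>, K)" by (cases s)
  from Cons.prems(2) obtain A' where A': "apply_rule s A = Some A'" "run A' ss = Some B"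
    by (auto simp: bind_eq_Some_conv)
  have "apply_rule (\<rho>, K) C = Some C"
    using assms(2) Cons.prems(1) s by (simp add: fixed_point_def)
  then have "refined_by A' C"
    using apply_rule_mono[of Xs \<rho> A C K A' C] A'(1) s Cons.prems(1,3) assms(1) by auto
  then show ?case using Cons.IH A'(2) Cons.prems(1) by simp
qed simp

lemma run_append: "run A (ss @ ts) = Option.bind (run A ss) (\<lambda>B. run B ts)"
  by (induction ss arbitrary: A) (simp_all split: Option.bind_split)

lemma run_take_Suc:
  assumes "i < length ss"
  shows "run A (take (Suc i) ss) = Option.bind (run A (take i ss)) (apply_rule (ss ! i))"
  using assms by (simp add: take_Suc_conv_app_nth run_append)

text \<open>
  Backwards from the end of the run, the assignment stays equal to the final one until the
  last strict update is met. Every rule is applied somewhere in this constant stretch, and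
  therefore fixes the final assignment.
\<close>

lemma run_reaches_fixed_point:
  assumes "run A ss = Some C" "all_applied_after_last_update R Ks A ss"
  shows "fixed_point R Ks C"
  unfolding fixed_point_def
proof
  fix s assume "s \<in> R \<times> Ks"
  then obtain j where j: "j < length ss" "ss ! j = s"
    and late: "\<And>i. strict_update A ss i \<Longrightarrow> i < j"
    using assms(2) unfolding all_applied_after_last_update_def by blast
  have const: "run A (take k ss) = Some C" if "j \<le> k" "k \<le> length ss" for k
    using that(2,1)
  proof (induction rule: inc_induct)
    case base
    then show ?case using assms(1) by simp
  next
    case (step i)
    then have next_C: "run A (take (Suc i) ss) = Some C" by simp
    with step.hyps obtain B where B: "run A (take i ss) = Some B"
      by (auto simp: run_take_Suc bind_eq_Some_conv)
    have "\<not> strict_update A ss i" using late step.prems by fastforce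
    with B next_C step.hyps show ?case by (simp add: strict_update_def)
  qed
  have "run A (take j ss) = Some C" "run A (take (Suc j) ss) = Some C"
    using const j(1) by simp_all
  then show "apply_rule s C = Some C"
    using run_take_Suc[OF j(1), of A] j(2) by simp
qed

section \<open>Independence of the order of rule applications\<close>

theorem proposition4p2:
  fixes Xs :: "'x set" and Ks :: "'k set"
    and R :: "'x rule set"
    and val :: "'x \<Rightarrow> 'k \<Rightarrow> int"
    and A0 :: "('x, 'k) assignment"
    and ss ss' :: "('x rule \<times> 'k) list"
  assumes "finite Xs" and "finite Ks" and "finite R"
    and "\<forall>\<rho>\<in>R. rule_over Xs \<rho>"
    and "admissible_endpoints Xs Ks A0"
    and "\<forall>X\<in>Xs. \<forall>K\<in>Ks. val X K \<in> stored_interval A0 X K"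
    and "\<forall>\<rho>\<in>R. \<forall>K\<in>Ks. valid_rule val K \<rho>"
    and "set ss \<subseteq> R \<times> Ks" and "all_applied_after_last_update R Ks A0 ss"
    and "set ss' \<subseteq> R \<times> Ks" and "all_applied_after_last_update R Ks A0 ss'"
  shows "\<exists>A. fixed_point R Ks A \<and> run A0 ss = Some A \<and> run A0 ss' = Some A"
proof -
  obtain A where A: "run A0 ss = Some A"
    using run_sound[OF assms(4,7,6,8)] by blast
  obtain B where B: "run A0 ss' = Some B"
    using run_sound[OF assms(4,7,6,10)] by blast
  have fixA: "fixed_point R Ks A" and fixB: "fixed_point R Ks B"
    using run_reaches_fixed_point A B assms(9,11) by blast+
  have "refined_by A B"
    using run_below_fixed_point[OF assms(4) fixB assms(8) A]
      refine_run[OF assms(4,10) B] by blast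
  moreover have "refined_by B A"
    using run_below_fixed_point[OF assms(4) fixA assms(10) B]
      refine_run[OF assms(4,8) A] by blast
  ultimately have "A = B" by (rule refined_by_antisym)
  with A B fixA show ?thesis by blast
qed

end
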